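(* A family of functions $\{\mathcal Q_k(\mathbf u)\}_{k\in\mathbb Z_{\ge0}}$ satisfies $$\mathcal Q_0(\mathbf u)=1,\quad\mathcal Q_1(\mathbf u)=u^{-1},\quad\mathcal Q_{k+1}(\mathbf u)=\frac{\mathcal Q_k(\mathbf u)^2-1}{u_k\,\mathcal Q_{k-1}(\mathbf u)}\quad(k\ge1)$$ if and only if it satisfies $$\mathcal Q_0(\mathbf u)=1,\quad\mathcal Q_1(\mathbf u)=u^{-1},\quad\mathcal Q_{k+1}(\mathbf u)=\mathcal Q_k(\mathbf u')\quad(k\ge1),$$ where $$u'=\frac1{\mathcal Q_2(\mathbf u)},\qquad u'_1=\mathcal Q_1(\mathbf u)u_2,\qquad u'_j=u_{j+1}\ (j>1),$$ and $\mathcal Q_2(\mathbf u)$ is defined by $\mathcal Q_2(\mathbf u)=\dfrac{u^{-2}-1}{u_1}$.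
   Context: $\mathbf u=(u;u_1,u_2,\dots)$ are formal variables; the $\mathcal Q_k(\mathbf u)=\mathcal Q_k(u;u_1,\dots,u_{k-1})$ are rational functions of them, and $\mathcal Q_k(\mathbf u')$ denotes substitution of $\mathbf u'=(u';u'_1,u'_2,\dots)$ for $\mathbf u$. *)

theory Defs
  imports "HOL-Library.Poly_Mapping" "HOL-Computational_Algebra.Fraction_Field"
begin

text \<open>
  Polynomials and rational functions in the countably many formal variables
  $u, u_1, u_2, \dots$ over a coefficient field. A monomial is a finitely supported exponent
  vector indexed by \<open>nat\<close>; index \<open>0\<close> stands for the variable $u$ and index \<open>i \<ge> 1\<close> for $u_i$.
\<close>

type_synonym 'a polyfun = "(nat \<Rightarrow>\<^sub>0 nat) \<Rightarrow>\<^sub>0 'a"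
type_synonym 'a ratfun = "'a polyfun fract"

definition ratfun_const :: "'a::field \<Rightarrow> 'a ratfun" where
  "ratfun_const c = Fract (Poly_Mapping.single 0 c) 1"

definition U :: "nat \<Rightarrow> 'a::field ratfun" where
  "U i = Fract (Poly_Mapping.single (Poly_Mapping.single i 1) 1) 1"

definition poly_subst :: "(nat \<Rightarrow> 'a ratfun) \<Rightarrow> 'a::field polyfun \<Rightarrow> 'a ratfun" where
  "poly_subst s p =
     (\<Sum>m\<in>Poly_Mapping.keys p. ratfun_const (Poly_Mapping.lookup p m) *
        (\<Prod>i\<in>Poly_Mapping.keys m. s i ^ Poly_Mapping.lookup m i))"

text \<open>
  Substitution into a rational function: write it as a quotient of polynomials whose denominator
  does not vanish under the substitution, and substitute in numerator and denominator. The value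
  does not depend on the representation (lemma \<open>ratfun_subst_Fract\<close> below). If there is no such
  representation, then the substitution is undefined and the value is \<open>0\<close> by convention.
\<close>

definition ratfun_subst :: "(nat \<Rightarrow> 'a ratfun) \<Rightarrow> 'a::field ratfun \<Rightarrow> 'a ratfun" where
  "ratfun_subst s f =
     (if \<exists>a b. f = Fract a b \<and> poly_subst s b \<noteq> 0
      then THE g. \<exists>a b. f = Fract a b \<and> poly_subst s b \<noteq> 0 \<and> g = poly_subst s a / poly_subst s b
      else 0)"

definition Q2 :: "'a::field ratfun" where
  "Q2 = (inverse (U 0) ^ 2 - 1) / U 1"

text \<open>The substituted variables $\mathbf u' = (u'; u_1', u_2', \dots)$, indexed as above.\<close>

definition u_prime :: "(nat \<Rightarrow> 'a::field ratfun) \<Rightarrow> nat \<Rightarrow> 'a ratfun" where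
  "u_prime Q j = (if j = 0 then 1 / Q2 else if j = 1 then Q 1 * U 2 else U (j + 1))"

lemma ratfun_const_0: "ratfun_const 0 = 0"
  by (simp add: ratfun_const_def Zero_fract_def)

lemma ratfun_const_1: "ratfun_const 1 = 1"
  by (simp add: ratfun_const_def One_fract_def)

lemma ratfun_const_add: "ratfun_const (c + d) = ratfun_const c + ratfun_const d"
  by (simp add: ratfun_const_def single_add)

lemma ratfun_const_mult: "ratfun_const (c * d) = ratfun_const c * ratfun_const d"
  by (simp add: ratfun_const_def mult_single)

definition monom_subst :: "(nat \<Rightarrow> 'a::field ratfun) \<Rightarrow> (nat \<Rightarrow>\<^sub>0 nat) \<Rightarrow> 'a ratfun" where
  "monom_subst s m = (\<Prod>i\<in>Poly_Mapping.keys m. s i ^ Poly_Mapping.lookup m i)"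

lemma monom_subst_superset:
  assumes "finite A" "Poly_Mapping.keys m \<subseteq> A"
  shows "monom_subst s m = (\<Prod>i\<in>A. s i ^ Poly_Mapping.lookup m i)"
  unfolding monom_subst_def
  by (rule prod.mono_neutral_left) (use assms in \<open>auto simp: in_keys_iff\<close>)

lemma monom_subst_add: "monom_subst s (m + n) = monom_subst s m * monom_subst s n"
proof -
  let ?A = "Poly_Mapping.keys m \<union> Poly_Mapping.keys n"
  have "monom_subst s (m + n) = (\<Prod>i\<in>?A. s i ^ Poly_Mapping.lookup (m + n) i)"
    by (rule monom_subst_superset) (auto simp: keys_add [THEN subsetD] dest: keys_add [THEN subsetD])
  also have "\<dots> = monom_subst s m * monom_subst s n"
    by (simp add: monom_subst_superset [of ?A] lookup_add power_add prod.distrib)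
  finally show ?thesis .
qed

lemma poly_subst_superset:
  assumes "finite A" "Poly_Mapping.keys p \<subseteq> A"
  shows "poly_subst s p = (\<Sum>m\<in>A. ratfun_const (Poly_Mapping.lookup p m) * monom_subst s m)"
  unfolding poly_subst_def monom_subst_def
  by (rule sum.mono_neutral_left) (use assms in \<open>auto simp: in_keys_iff ratfun_const_0\<close>)

lemma poly_subst_0: "poly_subst s 0 = 0"
  by (simp add: poly_subst_def)

lemma poly_subst_single: "poly_subst s (Poly_Mapping.single m c) = ratfun_const c * monom_subst s m"
  by (simp add: poly_subst_superset [of "{m}"])

lemma poly_subst_add: "poly_subst s (p + q) = poly_subst s p + poly_subst s q"
proof -
  let ?A = "Poly_Mapping.keys p \<union> Poly_Mapping.keys q"
  have "poly_subst s (p + q) = (\<Sum>m\<in>?A. ratfun_const (Poly_Mapping.lookup (p + q) m) * monom_subst s m)"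
    by (rule poly_subst_superset) (auto dest: keys_add [THEN subsetD])
  also have "\<dots> = poly_subst s p + poly_subst s q"
    by (simp add: poly_subst_superset [of ?A] lookup_add ratfun_const_add distrib_right sum.distrib)
  finally show ?thesis .
qed

lemma polyfun_induct [case_names zero add]:
  assumes "P 0" "\<And>m c p. P p \<Longrightarrow> P (Poly_Mapping.single m c + p)"
  shows "P (p :: 'a::field polyfun)"
proof -
  have "finite A \<Longrightarrow> P (\<Sum>m\<in>A. Poly_Mapping.single m (Poly_Mapping.lookup p m))" for A
    by (induction A rule: finite_induct) (auto intro: assms)
  moreover have "p = (\<Sum>m\<in>Poly_Mapping.keys p. Poly_Mapping.single m (Poly_Mapping.lookup p m))"
    by (rule poly_mapping_eqI)
      (auto simp: lookup_sum lookup_single when_def in_keys_iff)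
  ultimately show ?thesis
    by (metis finite_keys)
qed

lemma poly_subst_mult: "poly_subst s (p * q) = poly_subst s p * poly_subst s q"
proof (induction p rule: polyfun_induct)
  case zero
  show ?case by (simp add: poly_subst_0)
next
  case (add m c p)
  have "poly_subst s (Poly_Mapping.single m c * q) = poly_subst s (Poly_Mapping.single m c) * poly_subst s q"
  proof (induction q rule: polyfun_induct)
    case zero
    show ?case by (simp add: poly_subst_0)
  next
    case (add n d q)
    then show ?case
      by (simp add: poly_subst_add poly_subst_single mult_single ratfun_const_mult monom_subst_add
          algebra_simps)
  qed
  with add show ?case
    by (simp add: poly_subst_add algebra_simps)
qed

lemma ratfun_subst_Fract:
  assumes "poly_subst s b \<noteq> 0"
  shows "ratfun_subst s (Fract a b) = poly_subst s a / poly_subst s b"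
proof -
  have "poly_subst s c / poly_subst s d = poly_subst s a / poly_subst s b"
    if "Fract a b = Fract c d" "poly_subst s d \<noteq> 0" for c d
  proof -
    have "b \<noteq> 0" "d \<noteq> 0" using assms that(2) by (auto simp: poly_subst_0)
    with that(1) have "a * d = c * b" by (simp add: eq_fract)
    then have "poly_subst s a * poly_subst s d = poly_subst s c * poly_subst s b"
      by (metis poly_subst_mult)
    with assms that(2) show ?thesis by (simp add: frac_eq_eq)
  qed
  then have "(THE g. \<exists>c d. Fract a b = Fract c d \<and> poly_subst s d \<noteq> 0 \<and>
      g = poly_subst s c / poly_subst s d) = poly_subst s a / poly_subst s b"
    using assms by (intro the_equality) blast+
  with assms show ?thesis unfolding ratfun_subst_def by auto
qed

end

theory Submission
  imports Defs
begin

text \<open>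
  Both recursions determine the family uniquely, so it suffices that the solution \<open>R\<close> of the first
  one satisfies the second. Applying the substitution $\mathbf u \mapsto \mathbf u'$ to the
  recursion at index \<open>k\<close> yields the recursion at index \<open>k + 1\<close>, provided that no denominator
  vanishes. The latter holds because $\mathcal Q_k \neq 0$ and $\mathcal Q_k^2 \neq 1$: since
  $\mathcal Q_k$ and $\mathcal Q_{k-1}$ do not involve $u_k$, setting $u_k = 0$ in
  $u_k \mathcal Q_{k-1} \mathcal Q_{k+1} = \mathcal Q_k^2 - 1$ with
  $\mathcal Q_{k+1} = \pm 1$ would give $\mathcal Q_k^2 = 1$.
\<close>

text \<open>The graph of the partial substitution map. Unlike \<open>ratfun_subst\<close>, it
  separates a genuine value 0 from the default 0, so it is closed under field operations and a
  derivation of it also proves definedness.\<close>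

definition has_subst :: "(nat \<Rightarrow> 'a ratfun) \<Rightarrow> 'a::field ratfun \<Rightarrow> 'a ratfun \<Rightarrow> bool" where
  "has_subst s f g \<longleftrightarrow>
     (\<exists>a b. f = Fract a b \<and> poly_subst s b \<noteq> 0 \<and> g = poly_subst s a / poly_subst s b)"

lemma ratfun_subst_eqI: "has_subst s f g \<Longrightarrow> ratfun_subst s f = g"
  by (auto simp: has_subst_def ratfun_subst_Fract)

lemma has_subst_unique: "has_subst s f g \<Longrightarrow> has_subst s f h \<Longrightarrow> g = h"
  using ratfun_subst_eqI by blast

lemma poly_subst_1: "poly_subst s 1 = 1"
  using poly_subst_single[of s 0 1] by (simp add: ratfun_const_1 monom_subst_def)

lemma poly_subst_minus: "poly_subst s (- p) = - poly_subst s p"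
  using poly_subst_add[of s p "- p"] by (simp add: poly_subst_0 eq_neg_iff_add_eq_0 add.commute)

lemma has_subst_U: "has_subst s (U i) (s i)"
  unfolding has_subst_def U_def
  by (rule exI[of _ "Poly_Mapping.single (Poly_Mapping.single i 1) 1"], rule exI[of _ 1])
    (simp add: poly_subst_1 poly_subst_single ratfun_const_1 monom_subst_def)

lemma has_subst_1: "has_subst s 1 1"
  unfolding has_subst_def by (metis One_fract_def div_by_1 one_neq_zero poly_subst_1)

lemma has_subst_diff:
  assumes "has_subst s f f'" "has_subst s g g'"
  shows "has_subst s (f - g) (f' - g')"
proof -
  from assms obtain a b c d where
    ab: "f = Fract a b" "poly_subst s b \<noteq> 0" "f' = poly_subst s a / poly_subst s b" and
    cd: "g = Fract c d" "poly_subst s d \<noteq> 0" "g' = poly_subst s c / poly_subst s d"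
    unfolding has_subst_def by blast
  have "b \<noteq> 0" "d \<noteq> 0" using ab cd by (auto simp: poly_subst_0)
  then have "f - g = Fract (a * d + - (c * b)) (b * d)"
    by (simp add: ab cd)
  moreover have "f' - g' = poly_subst s (a * d + - (c * b)) / poly_subst s (b * d)"
    using ab cd
    by (simp only: poly_subst_add poly_subst_minus poly_subst_mult) (simp add: field_simps)
  moreover have "poly_subst s (b * d) \<noteq> 0"
    using ab cd by (simp add: poly_subst_mult)
  ultimately show ?thesis unfolding has_subst_def by blast
qed

lemma has_subst_mult:
  assumes "has_subst s f f'" "has_subst s g g'"
  shows "has_subst s (f * g) (f' * g')"
proof -
  from assms obtain a b c d where
    ab: "f = Fract a b" "poly_subst s b \<noteq> 0" "f' = poly_subst s a / poly_subst s b" and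
    cd: "g = Fract c d" "poly_subst s d \<noteq> 0" "g' = poly_subst s c / poly_subst s d"
    unfolding has_subst_def by blast
  then have "f * g = Fract (a * c) (b * d)" "poly_subst s (b * d) \<noteq> 0"
    "f' * g' = poly_subst s (a * c) / poly_subst s (b * d)"
    by (simp_all add: poly_subst_mult)
  then show ?thesis unfolding has_subst_def by blast
qed

lemma has_subst_inverse:
  assumes "has_subst s f f'" "f' \<noteq> 0"
  shows "has_subst s (inverse f) (inverse f')"
proof -
  from assms obtain a b where
    ab: "f = Fract a b" "poly_subst s b \<noteq> 0" "f' = poly_subst s a / poly_subst s b"
    unfolding has_subst_def by blast
  with assms(2) have "inverse f = Fract b a" "poly_subst s a \<noteq> 0"
    "inverse f' = poly_subst s b / poly_subst s a"
    by simp_all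
  then show ?thesis unfolding has_subst_def by blast
qed

lemma has_subst_divide:
  assumes "has_subst s f f'" "has_subst s g g'" "g' \<noteq> 0"
  shows "has_subst s (f / g) (f' / g')"
  using has_subst_mult[OF assms(1) has_subst_inverse[OF assms(2,3)]] by (simp add: divide_inverse)

lemma has_subst_square_minus_1:
  "has_subst s f f' \<Longrightarrow> has_subst s (f ^ 2 - 1) (f' ^ 2 - 1)"
  unfolding power2_eq_square by (intro has_subst_diff has_subst_mult has_subst_1)

text \<open>Setting all variables to 1 sends \<open>U i\<close> to 1 but 0 to 0.\<close>

lemma U_nonzero: "U i \<noteq> (0 :: 'a::field ratfun)"
proof
  assume "U i = (0 :: 'a ratfun)"
  moreover have "has_subst (\<lambda>_. 1) (0 :: 'a ratfun) 0"
    using has_subst_diff[OF has_subst_1 has_subst_1] by simp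
  ultimately show False
    using has_subst_unique[OF has_subst_U[of "\<lambda>_. 1" i]] by (metis one_neq_zero)
qed

fun R :: "nat \<Rightarrow> 'a::field ratfun" where
  "R 0 = 1"
| "R (Suc 0) = inverse (U 0)"
| "R (Suc (Suc k)) = (R (Suc k) ^ 2 - 1) / (U (Suc k) * R k)"

text \<open>Says semantically that \<open>R k\<close> involves only variables of index below
  \<open>k\<close>. Nonvanishing is a hypothesis because the lemma is applied inside the induction
  that establishes it.\<close>

lemma R_fixed:
  assumes "\<And>k. k < n \<Longrightarrow> R k \<noteq> (0 :: 'a::field ratfun)" and "\<And>i. i < n \<Longrightarrow> s i = U i" and "k \<le> n"
  shows "has_subst s (R k :: 'a ratfun) (R k)"
  using assms(3)
proof (induction k rule: R.induct)
  case 1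
  show ?case by (simp add: has_subst_1)
next
  case 2
  then show ?case
    using has_subst_inverse[OF has_subst_U[of s 0]] assms(2)[of 0] by (simp add: U_nonzero)
next
  case (3 k)
  have "has_subst s (U (Suc k)) (U (Suc k))"
    using has_subst_U[of s "Suc k"] assms(2)[of "Suc k"] 3 by simp
  moreover have "R k \<noteq> (0 :: 'a ratfun)" using assms(1)[of k] 3 by simp
  ultimately show ?case
    using 3 by simp
      (intro has_subst_divide has_subst_mult has_subst_square_minus_1; simp add: U_nonzero)
qed

text \<open>The index starts at 1 since \<open>R 0 ^ 2 = 1\<close>. The two claims are proved
  together: the second at one index yields the first at the next.\<close>

lemma R_nondegenerate: "R (Suc k) \<noteq> (0 :: 'a::field ratfun) \<and> R (Suc k) ^ 2 \<noteq> (1 :: 'a ratfun)"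
proof (induction k rule: less_induct)
  case (less n)
  have prev: "R k \<noteq> (0 :: 'a ratfun)" if "k \<le> n" for k
    using that less by (cases k) auto
  define s where "s = U(n := 0 :: 'a ratfun)"
  have Un: "has_subst s (U n) 0"
    using has_subst_U[of s n] by (simp add: s_def)
  show ?case
  proof (cases n)
    case 0
    have "U 0 ^ 2 \<noteq> (1 :: 'a ratfun)"
    proof
      \<comment> \<open>As \<open>R 1\<close> is the inverse of \<open>U 0\<close>, its square is 1
        only if this holds; putting \<open>U 0\<close> to 0 then gives 1 = 0.\<close>
      assume "U 0 ^ 2 = (1 :: 'a ratfun)"
      then have "has_subst s 1 (0 * 0)"
        using has_subst_mult[OF Un Un] 0 by (simp add: power2_eq_square)
      then show False using has_subst_unique[OF has_subst_1] by fastforce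
    qed
    then show ?thesis
      using 0 by (simp add: U_nonzero power_inverse)
  next
    case (Suc m)
    have sq: "R n ^ 2 \<noteq> (1 :: 'a ratfun)" using less[of m] Suc by simp
    have rec: "U n * R m * R (Suc n) = (R n ^ 2 - 1 :: 'a ratfun)"
      using Suc prev[of m] by (simp add: U_nonzero)
    have fixed: "has_subst s (R k) (R k)" if "k \<le> n" for k
      by (rule R_fixed[of n]) (use that prev in \<open>simp_all add: s_def\<close>)
    have "R (Suc n) ^ 2 \<noteq> (1 :: 'a ratfun)"
    proof
      assume "R (Suc n) ^ 2 = (1 :: 'a ratfun)"
      \<comment> \<open>Squaring the recursion treats both signs of \<open>R (Suc n)\<close> at once
        and eliminates it. Under \<open>s\<close> the left side becomes 0, while the right side is
        unchanged.\<close>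
      then have "(U n * R m) ^ 2 = (R n ^ 2 - 1 :: 'a ratfun) ^ 2"
        by (metis rec mult.right_neutral power_mult_distrib)
      moreover have "has_subst s ((U n * R m) ^ 2) (0 * R m * (0 * R m))"
        unfolding power2_eq_square using Suc by (intro has_subst_mult Un fixed) simp_all
      moreover have "has_subst s ((R n ^ 2 - 1) ^ 2) ((R n ^ 2 - 1) * (R n ^ 2 - 1))"
        unfolding power2_eq_square[of "R n ^ 2 - 1"]
        by (intro has_subst_mult has_subst_square_minus_1 fixed) simp_all
      ultimately have "(R n ^ 2 - 1) * (R n ^ 2 - 1) = (0 :: 'a ratfun)"
        using has_subst_unique by fastforce
      with sq show False by simp
    qed
    moreover have "R (Suc n) \<noteq> (0 :: 'a ratfun)" using rec sq by auto
    ultimately show ?thesis by blast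
  qed
qed

lemma R_nonzero: "R k \<noteq> 0"
  using R_nondegenerate by (cases k) auto

text \<open>Stated for any \<open>s\<close> with these values, so that it applies to
  \<open>u_prime Q\<close> as soon as \<open>Q 1\<close> is known.\<close>

lemma has_subst_R:
  assumes "s 0 = 1 / Q2" "s 1 = inverse (U 0) * U 2" "\<And>j. j > 1 \<Longrightarrow> s j = U (j + 1)"
  shows "has_subst s (R (Suc k)) (R (Suc (Suc k)))"
proof -
  have Q2: "R (Suc (Suc 0)) = Q2" by (simp add: Q2_def)
  \<comment> \<open>Nonvanishing of \<open>Q2\<close> makes the inverse of u' defined, with value
    \<open>Q2\<close>.\<close>
  have "s 0 \<noteq> 0" using R_nonzero[of "Suc (Suc 0)"] unfolding Q2 assms(1) by simp
  then have base: "has_subst s (R (Suc 0)) (R (Suc (Suc 0)))"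
    using has_subst_inverse[OF has_subst_U[of s 0]] unfolding Q2 assms(1) by simp
  show ?thesis
  proof (induction k rule: R.induct)
    case 1
    show ?case by (rule base)
  next
    case 2
    \<comment> \<open>Here the shift pattern breaks: \<open>R 0 = 1\<close> goes to 1, not to
      \<open>R 1\<close>. The extra factor \<open>inverse (U 0) = R 1\<close> in u'_1 compensates,
      giving the denominator \<open>U 2 * R 1\<close> of \<open>R 3\<close>.\<close>
    have "has_subst s (U (Suc 0) * R 0) (inverse (U 0) * U 2 * 1)"
      using has_subst_mult[OF has_subst_U[of s 1] has_subst_1] assms(2) by simp
    then have "has_subst s (R (Suc (Suc 0)))
        ((R (Suc (Suc 0)) ^ 2 - 1) / (inverse (U 0) * U 2 * 1))"
      unfolding R.simps(3)[of 0]
      by (intro has_subst_divide has_subst_square_minus_1 base[unfolded R.simps(3)[of 0]])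
        (simp_all add: U_nonzero)
    then show ?case by (simp add: mult.commute numeral_2_eq_2)
  next
    case (3 k)
    have "has_subst s (U (Suc (Suc k))) (U (Suc (Suc (Suc k))))"
      using has_subst_U[of s "Suc (Suc k)"] assms(3)[of "Suc (Suc k)"] by simp
    with 3 show ?case
      unfolding R.simps(3)[of "Suc k"] R.simps(3)[of "Suc (Suc k)"]
      by (intro has_subst_divide has_subst_square_minus_1 has_subst_mult)
        (simp_all del: R.simps add: U_nonzero R_nonzero)
  qed
qed

lemma R_unique:
  assumes "Q 0 = 1" "Q 1 = inverse (U 0)"
    "\<And>k. k \<ge> 1 \<Longrightarrow> Q (k + 1) = (Q k ^ 2 - 1) / (U k * Q (k - 1))"
  shows "Q = R"
proof
  show "Q k = R k" for k
  proof (induction k rule: R.induct)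
    case (3 k)
    then show ?case using assms(3)[of "Suc k"] by simp
  qed (use assms in simp_all)
qed

lemma R_unique_subst:
  assumes "Q 0 = 1" "Q 1 = inverse (U 0)"
    "\<And>k. k \<ge> 1 \<Longrightarrow> Q (k + 1) = ratfun_subst (u_prime Q) (Q k)"
  shows "Q = R"
proof
  \<comment> \<open>\<open>u_prime Q\<close> depends on \<open>Q\<close> only through
    \<open>Q 1\<close>, so there is no circularity in using it before \<open>Q = R\<close> is
    known.\<close>
  have subst: "has_subst (u_prime Q) (R (Suc k)) (R (Suc (Suc k)))" for k
    by (rule has_subst_R) (use assms(2) in \<open>simp_all add: u_prime_def\<close>)
  show "Q k = R k" for k
  proof (induction k rule: R.induct)
    case (3 k)
    then show ?case
      using assms(3)[of "Suc k"] ratfun_subst_eqI[OF subst[of k]] by simp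
  qed (use assms in simp_all)
qed

theorem lemma3p1:
  fixes Q :: "nat \<Rightarrow> 'a::field ratfun"
  shows "(Q 0 = 1 \<and> Q 1 = inverse (U 0) \<and>
            (\<forall>k\<ge>1. Q (k + 1) = (Q k ^ 2 - 1) / (U k * Q (k - 1))))
         \<longleftrightarrow>
         (Q 0 = 1 \<and> Q 1 = inverse (U 0) \<and>
            (\<forall>k\<ge>1. Q (k + 1) = ratfun_subst (u_prime Q) (Q k)))"
    (is "?rec Q \<longleftrightarrow> ?subst Q")
proof -
  have "R (k + 1) = (R k ^ 2 - 1) / (U k * R (k - 1) :: 'a ratfun)" if "k \<ge> 1" for k
    using that by (cases k) simp_all
  then have "?rec R" by simp
  moreover have "has_subst (u_prime R) (R (Suc k)) (R (Suc (Suc k)) :: 'a ratfun)" for k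
    by (rule has_subst_R) (simp_all add: u_prime_def)
  then have "R (k + 1) = ratfun_subst (u_prime R) (R k :: 'a ratfun)" if "k \<ge> 1" for k
    using that by (cases k) (simp_all del: R.simps(3) add: ratfun_subst_eqI[symmetric])
  then have "?subst R" by simp
  ultimately show ?thesis
    using R_unique[of Q] R_unique_subst[of Q] by blast
qed

end
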